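(* Let $y_0\in\mathbb{R}^n$, let $p_0\in\mathbb{R}^n$ be a solution of the dual interpolation problem $(D_0)$, and let $\eta_0=K_*p_0$. Fix $\pi\in\{0,1\}^n$ and $J\subset I$, and set $$z_0:=\sum_{i\in J}p_0^i\pi_ix^i,\qquad \tilde z_0:=P_{L^J}z_0.$$ If there exists $w_0\in R_\pi^J\cap\mathbb{S}^{d-1}$ such that $|\eta_0(w_0)|=1$, then $\tilde z_0\ne0$ and $$w_0=\operatorname{sign}(\eta_0(w_0))\,\frac{\tilde z_0}{\|\tilde z_0\|}.$$ Moreover, $|\eta_0(w)|<1$ for every $w\in\big(\overline{R}_\pi^J\cap\mathbb{S}^{d-1}\big)\setminus\{w_0\}$.
   Context: Setting. $d,n$ are positive integers, $x^1,\dots,x^n\in\mathbb{R}^d\setminus\{0\}$ are given data points, $I=\{1,\dots,n\}$, and $\sigma(z)=\max\{0,z\}$ is the ReLU function. $K_*:\mathbb{R}^n\to C(\mathbb{S}^{d-1})$ is $K_*p(w)=\sum_{j=1}^np^j\sigma(\langle w,x^j\rangle)$. The dual interpolation problem $(D_0)$ is: maximize $\langle p,y_0\rangle$ over $p\in\mathbb{R}^n$ with $\|K_*p\|_\infty=\sup_{w\in\mathbb{S}^{d-1}}|K_*p(w)|\le1$. Dual regions (strata). For $i\in I$ let $H_i=\{w\in\mathbb{R}^d:\langle w,x^i\rangle=0\}$, $A_i^1=\{w\in\mathbb{R}^d:\langle w,x^i\rangle>0\}$, $A_i^0=\{w\in\mathbb{R}^d:\langle w,x^i\rangle<0\}$.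 For $\pi\in\{0,1\}^n$ and $J\subset I$, $$R_\pi^J:=\Big(\bigcap_{j\in J}A_j^{\pi_j}\Big)\cap\Big(\bigcap_{z\in I\setminus J}H_z\Big),\qquad L^J:=\bigcap_{z\in I\setminus J}H_z$$ (so $L^I=\mathbb{R}^d$). $\overline R_\pi^J$ is the closure of $R_\pi^J$ in the relative topology of $L^J$, and $P_{L^J}$ is the orthogonal projection of $\mathbb{R}^d$ onto $L^J$. *)

theory Defs
  imports "HOL-Analysis.Analysis"
begin

text \<open>
  The points \<open>x i\<close> of \<open>\<real>\<^sup>d\<close> are indexed by a finite type \<open>'n\<close> in the role of
  \<open>I = {1,\<dots>,n}\<close>, with \<open>d = CARD('d)\<close> and \<open>n = CARD('n)\<close>, both of which are positive.
\<close>

definition relu :: "real \<Rightarrow> real" where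
  "relu z = max 0 z"

text \<open>
  \<open>K_star x p\<close> is given by its formula on all of \<open>\<real>\<^sup>d\<close>; as an element of
  \<open>C(S\<^sup>d\<^sup>-\<^sup>1)\<close> it is only its restriction to \<open>sphere 0 1\<close>.
\<close>

definition K_star :: "('n::finite \<Rightarrow> real^'d) \<Rightarrow> real^'n \<Rightarrow> real^'d \<Rightarrow> real" where
  "K_star x p w = (\<Sum>j\<in>UNIV. p $ j * relu (w \<bullet> x j))"

definition sphere_sup_norm :: "(real^'d \<Rightarrow> real) \<Rightarrow> real" where
  "sphere_sup_norm f = (SUP w\<in>sphere 0 1. \<bar>f w\<bar>)"

lemma continuous_on_K_star: "continuous_on S (K_star x p)"
  unfolding K_star_def relu_def by (intro continuous_intros)

text \<open>The supremum in \<open>sphere_sup_norm (K_star x p)\<close> is a genuine one.\<close>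

lemma bdd_above_K_star: "bdd_above ((\<lambda>w. \<bar>K_star x p w\<bar>) ` sphere 0 1)"
  by (intro bounded_imp_bdd_above compact_imp_bounded compact_continuous_image
      continuous_intros continuous_on_K_star compact_sphere)

definition dual_feasible :: "('n::finite \<Rightarrow> real^'d) \<Rightarrow> (real^'n) set" where
  "dual_feasible x = {p. sphere_sup_norm (K_star x p) \<le> 1}"

definition dual_solution :: "('n::finite \<Rightarrow> real^'d) \<Rightarrow> real^'n \<Rightarrow> real^'n \<Rightarrow> bool" where
  "dual_solution x y0 p \<longleftrightarrow>
     p \<in> dual_feasible x \<and> (\<forall>q\<in>dual_feasible x. q \<bullet> y0 \<le> p \<bullet> y0)"

definition hyperplane :: "('n \<Rightarrow> real^'d) \<Rightarrow> 'n \<Rightarrow> (real^'d) set" where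
  "hyperplane x i = {w. w \<bullet> x i = 0}"

text \<open>
  A sign pattern \<open>\<pi> \<in> {0,1}\<^sup>n\<close> is a map \<open>'n \<Rightarrow> bool\<close> with \<open>True\<close> for \<open>1\<close> and
  \<open>False\<close> for \<open>0\<close>; its numerical value is \<open>of_bool (\<pi> i)\<close>.
\<close>

definition open_half_space :: "('n \<Rightarrow> real^'d) \<Rightarrow> 'n \<Rightarrow> bool \<Rightarrow> (real^'d) set" where
  "open_half_space x i b = (if b then {w. w \<bullet> x i > 0} else {w. w \<bullet> x i < 0})"

definition stratum_space :: "('n \<Rightarrow> real^'d) \<Rightarrow> 'n set \<Rightarrow> (real^'d) set" where
  "stratum_space x J = (\<Inter>z\<in>- J. hyperplane x z)"

definition dual_region :: "('n \<Rightarrow> real^'d) \<Rightarrow> ('n \<Rightarrow> bool) \<Rightarrow> 'n set \<Rightarrow> (real^'d) set" where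
  "dual_region x \<pi> J =
     (\<Inter>j\<in>J. open_half_space x j (\<pi> j)) \<inter> (\<Inter>z\<in>- J. hyperplane x z)"

definition dual_region_closure ::
    "('n \<Rightarrow> real^'d) \<Rightarrow> ('n \<Rightarrow> bool) \<Rightarrow> 'n set \<Rightarrow> (real^'d) set" where
  "dual_region_closure x \<pi> J =
     top_of_set (stratum_space x J) closure_of dual_region x \<pi> J"

definition orth_proj :: "'a::euclidean_space set \<Rightarrow> 'a \<Rightarrow> 'a" where
  "orth_proj S z = (THE v. v \<in> S \<and> (\<forall>u\<in>S. orthogonal (z - v) u))"

lemma orth_proj_unique:
  fixes S :: "'a::euclidean_space set"
  assumes "subspace S"
  shows "\<exists>!v. v \<in> S \<and> (\<forall>u\<in>S. orthogonal (z - v) u)"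
proof -
  obtain v w where "v \<in> span S" "\<And>u. u \<in> span S \<Longrightarrow> orthogonal w u" "z = v + w"
    using orthogonal_subspace_decomp_exists [of S z] by metis
  then have ex: "v \<in> S" "\<forall>u\<in>S. orthogonal (z - v) u"
    using span_eq_iff [THEN iffD2, OF assms] by auto
  have "v' = v" if v': "v' \<in> S" "\<forall>u\<in>S. orthogonal (z - v') u" for v'
  proof -
    have "v' - v \<in> S"
      using assms v' ex by (simp add: subspace_diff)
    then have "(z - v) \<bullet> (v' - v) = 0" "(z - v') \<bullet> (v' - v) = 0"
      using v' ex by (auto simp: orthogonal_def)
    then have "(v' - v) \<bullet> (v' - v) = 0"
      by (simp add: inner_diff_left)
    then show ?thesis by simp
  qed
  with ex show ?thesis by blast
qed

lemma subspace_stratum_space: "subspace (stratum_space x J)"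
  unfolding stratum_space_def hyperplane_def
  by (auto simp: subspace_def inner_add_left)

end

theory Submission
  imports Defs
begin

text \<open>
  On the closed stratum \<open>\<eta>\<^sub>0\<close> is the linear form \<open>w \<mapsto> \<langle>w, z\<rangle>\<close> with \<open>z = P z\<^sub>0\<close>, and by positive
  homogeneity feasibility of \<open>p\<^sub>0\<close> says \<open>\<bar>\<eta>\<^sub>0 w\<bar> \<le> \<parallel>w\<parallel>\<close> everywhere. The stratum is relatively open, so
  \<open>w\<^sub>0\<close> may be moved a little in the direction \<open>s z\<close>, where \<open>s = sgn (\<eta>\<^sub>0 w\<^sub>0)\<close>; comparing first order
  terms in the bound gives \<open>\<parallel>z\<parallel> \<le> 1\<close>. As \<open>\<langle>w\<^sub>0, s z\<rangle> = 1 = \<parallel>w\<^sub>0\<parallel>\<close>, this forces \<open>w\<^sub>0 = s z\<close>. The only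
  other point of the sphere where \<open>\<bar>\<langle>w, z\<rangle>\<bar> = 1\<close> is \<open>-w\<^sub>0\<close>, which lies outside the closed stratum.
\<close>

lemma relu_mult: "0 \<le> c \<Longrightarrow> relu (c * a) = c * relu a"
  by (simp add: relu_def max_mult_distrib_left)

lemma K_star_scaleR: "0 \<le> c \<Longrightarrow> K_star x p (c *\<^sub>R w) = c * K_star x p w"
  by (simp add: K_star_def relu_mult sum_distrib_left algebra_simps)

lemma dual_feasible_bound:
  assumes "p \<in> dual_feasible x"
  shows "\<bar>K_star x p w\<bar> \<le> norm w"
proof (cases "w = 0")
  case True
  then show ?thesis by (simp add: K_star_def relu_def)
next
  case False
  then have "w /\<^sub>R norm w \<in> sphere 0 1" by simp
  then have "\<bar>K_star x p (w /\<^sub>R norm w)\<bar> \<le> sphere_sup_norm (K_star x p)"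
    unfolding sphere_sup_norm_def by (intro cSUP_upper bdd_above_K_star)
  also have "\<dots> \<le> 1" using assms by (simp add: dual_feasible_def)
  finally show ?thesis
    using False by (simp add: K_star_scaleR abs_mult field_simps)
qed

lemma orth_proj_subspace:
  assumes "subspace S"
  shows orth_proj_in: "orth_proj S z \<in> S"
    and orth_proj_inner: "u \<in> S \<Longrightarrow> u \<bullet> orth_proj S z = u \<bullet> z"
proof -
  have *: "orth_proj S z \<in> S \<and> (\<forall>u\<in>S. orthogonal (z - orth_proj S z) u)"
    unfolding orth_proj_def by (rule theI' [OF orth_proj_unique [OF assms]])
  then show "orth_proj S z \<in> S" by blast
  show "u \<bullet> orth_proj S z = u \<bullet> z" if "u \<in> S"
    using * that by (simp add: orthogonal_def inner_diff_left inner_commute [of u])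
qed

text \<open>
  For \<open>j \<in> J\<close> the two cases of the closed half space are merged into the single equation
  \<open>relu \<langle>w, x\<^sub>j\<rangle> = \<pi>\<^sub>j \<langle>w, x\<^sub>j\<rangle>\<close>.
\<close>

lemma dual_region_closure_subset:
  "dual_region_closure x \<pi> J \<subseteq>
    {w \<in> stratum_space x J. \<forall>j\<in>J. relu (w \<bullet> x j) = of_bool (\<pi> j) * (w \<bullet> x j)}"
proof -
  have "closed {w. \<forall>j\<in>J. relu (w \<bullet> x j) = of_bool (\<pi> j) * (w \<bullet> x j)}"
    unfolding relu_def Collect_ball_eq
    by (intro closed_INT ballI closed_Collect_eq continuous_intros)
  then have "closedin (top_of_set (stratum_space x J))
      (stratum_space x J \<inter> {w. \<forall>j\<in>J. relu (w \<bullet> x j) = of_bool (\<pi> j) * (w \<bullet> x j)})"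
    by (rule closedin_closed_Int)
  moreover have "dual_region x \<pi> J \<subseteq>
      stratum_space x J \<inter> {w. \<forall>j\<in>J. relu (w \<bullet> x j) = of_bool (\<pi> j) * (w \<bullet> x j)}"
  proof -
    have "relu (w \<bullet> x j) = of_bool b * (w \<bullet> x j)" if "w \<in> open_half_space x j b" for w j b
      using that by (cases b) (auto simp: open_half_space_def relu_def)
    then show ?thesis by (auto simp: dual_region_def stratum_space_def)
  qed
  ultimately show ?thesis
    unfolding dual_region_closure_def Collect_conj_eq Collect_mem_eq by (intro closure_of_minimal)
qed

lemma dual_region_subset_closure: "dual_region x \<pi> J \<subseteq> dual_region_closure x \<pi> J"
  unfolding dual_region_closure_def
  by (rule closure_of_subset) (auto simp: dual_region_def stratum_space_def)

lemma K_star_on_stratum: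
  assumes "w \<in> dual_region_closure x \<pi> J"
  shows "K_star x p w =
    w \<bullet> orth_proj (stratum_space x J) (\<Sum>i\<in>J. (p $ i * of_bool (\<pi> i)) *\<^sub>R x i)"
proof -
  have w: "w \<in> stratum_space x J" and eq: "\<forall>j\<in>J. relu (w \<bullet> x j) = of_bool (\<pi> j) * (w \<bullet> x j)"
    using assms dual_region_closure_subset by blast+
  have "w \<bullet> x j = 0" if "j \<notin> J" for j
    using w that by (auto simp: stratum_space_def hyperplane_def)
  then have "K_star x p w = (\<Sum>j\<in>J. p $ j * relu (w \<bullet> x j))"
    unfolding K_star_def by (intro sum.mono_neutral_right) (auto simp: relu_def)
  also have "\<dots> = w \<bullet> (\<Sum>i\<in>J. (p $ i * of_bool (\<pi> i)) *\<^sub>R x i)"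
    using eq by (auto simp: inner_sum_right mult.assoc intro!: sum.cong)
  finally show ?thesis
    by (simp add: orth_proj_inner [OF subspace_stratum_space w])
qed

text \<open>For any \<open>j\<close> in \<open>J\<close> the number \<open>w \<bullet> x j\<close>
  is nonzero with the sign dictated by \<open>\<pi> j\<close>, so the relu equation valid on the
  closure fails at \<open>- w\<close>. For empty \<open>J\<close> the stratum is a whole subspace
  and contains \<open>- w\<close>.\<close>

lemma uminus_notin_dual_region_closure:
  assumes "w \<in> dual_region x \<pi> J" "J \<noteq> {}"
  shows "- w \<notin> dual_region_closure x \<pi> J"
proof
  assume "- w \<in> dual_region_closure x \<pi> J"
  moreover obtain j where "j \<in> J" using assms by blast
  ultimately have "relu (- (w \<bullet> x j)) = - of_bool (\<pi> j) * (w \<bullet> x j)"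
    using dual_region_closure_subset by fastforce
  moreover have "w \<in> open_half_space x j (\<pi> j)"
    using assms \<open>j \<in> J\<close> by (auto simp: dual_region_def)
  ultimately show False
    by (auto simp: open_half_space_def relu_def split: if_splits)
qed

text \<open>The finitely many strict inequalities persist for small \<open>t\<close> by continuity;
  the equations persist for every \<open>t\<close> because \<open>v\<close> satisfies them
  too.\<close>

lemma dual_region_relatively_open:
  fixes x :: "'n::finite \<Rightarrow> real^'d"
  assumes "w \<in> dual_region x \<pi> J" "v \<in> stratum_space x J"
  obtains t where "t > 0" "w + t *\<^sub>R v \<in> dual_region x \<pi> J"
proof -
  have lim: "((\<lambda>t. (w + t *\<^sub>R v) \<bullet> x j) \<longlongrightarrow> (w + 0 *\<^sub>R v) \<bullet> x j) (at_right 0)" for j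
    by (intro tendsto_intros)
  have "\<forall>\<^sub>F t in at_right 0. w + t *\<^sub>R v \<in> open_half_space x j (\<pi> j)" if "j \<in> J" for j
  proof -
    have "w \<in> open_half_space x j (\<pi> j)" using assms that by (auto simp: dual_region_def)
    then show ?thesis
      using order_tendstoD [OF lim [of j], of 0] by (auto simp: open_half_space_def split: if_splits)
  qed
  then have "\<forall>\<^sub>F t in at_right 0. \<forall>j\<in>J. w + t *\<^sub>R v \<in> open_half_space x j (\<pi> j)"
    by (intro eventually_ball_finite finite) auto
  then have "\<forall>\<^sub>F t in at_right 0. t > (0::real) \<and> (\<forall>j\<in>J. w + t *\<^sub>R v \<in> open_half_space x j (\<pi> j))"
    by (intro eventually_conj eventually_at_right_less)
  then obtain t where t: "t > 0" "\<forall>j\<in>J. w + t *\<^sub>R v \<in> open_half_space x j (\<pi> j)"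
    by (metis (no_types, lifting) eventually_happens trivial_limit_at_right_real)
  moreover have "w + t *\<^sub>R v \<in> stratum_space x J"
    using assms by (auto simp: dual_region_def stratum_space_def hyperplane_def inner_add_left)
  ultimately show thesis
    using that by (auto simp: dual_region_def stratum_space_def)
qed

text \<open>Equality case of Cauchy-Schwarz: the squared distance of \<open>w\<close> and
  \<open>v\<close> is at most 1 - 2 + 1 = 0.\<close>

lemma unit_vector_eq_if_inner_ge_1:
  fixes v w :: "'a::real_inner"
  assumes "norm w = 1" "norm v \<le> 1" "w \<bullet> v \<ge> 1"
  shows "w = v"
proof -
  have "v \<bullet> v \<le> 1" using assms(2) by (simp add: norm_le_square)
  moreover have "w \<bullet> w = 1" using assms(1) by (simp add: norm_eq_1)
  ultimately have "(w - v) \<bullet> (w - v) \<le> 0"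
    using assms(3) by (simp add: inner_diff inner_commute)
  then have "(w - v) \<bullet> (w - v) = 0" by (intro antisym inner_ge_zero)
  then show ?thesis by simp
qed

theorem lemma3p7:
  fixes x :: "'n::finite \<Rightarrow> real^'d"
    and y0 p0 :: "real^'n"
    and \<pi> :: "'n \<Rightarrow> bool"
    and J :: "'n set"
    and \<eta>0 :: "real^'d \<Rightarrow> real"
    and z0 z0' w0 :: "real^'d"
  assumes x_nonzero: "\<And>i. x i \<noteq> 0"
    and solution: "dual_solution x y0 p0"
    and \<eta>0: "\<eta>0 = K_star x p0"
    and z0: "z0 = (\<Sum>i\<in>J. (p0 $ i * of_bool (\<pi> i)) *\<^sub>R x i)"
    and z0': "z0' = orth_proj (stratum_space x J) z0"
    and w0: "w0 \<in> dual_region x \<pi> J \<inter> sphere 0 1"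
    and extremal: "\<bar>\<eta>0 w0\<bar> = 1"
  shows "z0' \<noteq> 0
    \<and> w0 = sgn (\<eta>0 w0) *\<^sub>R (z0' /\<^sub>R norm z0')
    \<and> (\<forall>w \<in> (dual_region_closure x \<pi> J \<inter> sphere 0 1) - {w0}. \<bar>\<eta>0 w\<bar> < 1)"
proof -
  let ?C = "dual_region_closure x \<pi> J"
  define s where "s = sgn (\<eta>0 w0)"
  define v where "v = s *\<^sub>R z0'"
  have w0R: "w0 \<in> dual_region x \<pi> J" and nw0: "norm w0 = 1"
    using w0 by auto
  have bound: "\<bar>\<eta>0 w\<bar> \<le> norm w" for w
    using dual_feasible_bound solution by (auto simp: \<eta>0 dual_solution_def)
  have lin: "\<eta>0 w = w \<bullet> z0'" if "w \<in> ?C" for w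
    using K_star_on_stratum [OF that] by (simp add: \<eta>0 z0 z0')
  have w0C: "w0 \<in> ?C" using w0R dual_region_subset_closure by blast
  have s: "\<bar>s\<bar> = 1" "s * \<eta>0 w0 = 1" "s * s = 1"
    using extremal by (auto simp: s_def abs_if sgn_if split: if_splits)
  have w0v: "w0 \<bullet> v = 1"
    using s lin [OF w0C] by (simp add: v_def)
  have vL: "v \<in> stratum_space x J"
    unfolding v_def z0' by (intro subspace_scale orth_proj_in subspace_stratum_space)
  obtain t where t: "t > 0" "w0 + t *\<^sub>R v \<in> dual_region x \<pi> J"
    using dual_region_relatively_open [OF w0R vL] .
  have nv: "norm v \<le> 1"
  proof (rule ccontr)
    assume "\<not> norm v \<le> 1"
    then have gt: "v \<bullet> v > 1" by (simp add: norm_le_square)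
    have "(w0 + t *\<^sub>R v) \<bullet> v = s * \<eta>0 (w0 + t *\<^sub>R v)"
      unfolding lin [OF subsetD [OF dual_region_subset_closure t(2)]] by (simp add: v_def)
    also have "\<dots> \<le> \<bar>\<eta>0 (w0 + t *\<^sub>R v)\<bar>"
      using s(1) by (metis abs_ge_self abs_mult mult_1)
    also have "\<dots> \<le> norm (w0 + t *\<^sub>R v)" by (rule bound)
    finally have "1 + t * (v \<bullet> v) \<le> norm (w0 + t *\<^sub>R v)"
      by (simp add: inner_add_left w0v)
    \<comment> \<open>With a = \<open>v \<bullet> v\<close>, squaring leads to 2ta + (ta)^2 \<le> 2t
      + t(ta). If a > 1, then ta > t, and each term on the left exceeds its counterpart on the
      right.\<close>
    then have "(1 + t * (v \<bullet> v))\<^sup>2 \<le> (norm (w0 + t *\<^sub>R v))\<^sup>2"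
      using t(1) by (intro power_mono) auto
    also have "\<dots> = 1 + 2 * t + t * (t * (v \<bullet> v))"
      using nw0 w0v by (simp add: power2_norm_eq_inner inner_add inner_commute norm_eq_1)
    finally have "2 * (t * (v \<bullet> v)) + (t * (v \<bullet> v)) * (t * (v \<bullet> v)) \<le> 2 * t + t * (t * (v \<bullet> v))"
      by (simp add: power2_eq_square algebra_simps)
    moreover have tv: "t < t * (v \<bullet> v)" using t(1) gt by simp
    moreover have "t * (t * (v \<bullet> v)) < (t * (v \<bullet> v)) * (t * (v \<bullet> v))"
      using tv t(1) by (intro mult_strict_right_mono) linarith+
    ultimately show False by linarith
  qed
  have w0_eq: "w0 = v"
    using unit_vector_eq_if_inner_ge_1 nw0 nv w0v by force
  \<comment> \<open>Unit length makes the normalisation in the conclusion trivial and yields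
    \<open>z0' \<noteq> 0\<close>.\<close>
  then have nz: "norm z0' = 1"
    using nw0 s(1) by (simp add: v_def)
  \<comment> \<open>An empty \<open>J\<close> would make \<open>z0\<close> an empty sum, so the
    linear form would vanish at \<open>w0\<close>, where it has absolute value 1.\<close>
  have "J \<noteq> {}"
  proof
    assume "J = {}"
    then have "w0 \<bullet> z0' = 0"
      using orth_proj_inner [OF subspace_stratum_space, of w0 x J 0] w0R
      by (simp add: z0 z0' dual_region_def stratum_space_def)
    then show False using w0v by (simp add: v_def)
  qed
  then have notC: "- w0 \<notin> ?C"
    by (rule uminus_notin_dual_region_closure [OF w0R])
  have "\<bar>\<eta>0 w\<bar> < 1" if w: "w \<in> (?C \<inter> sphere 0 1) - {w0}" for w
  proof (rule ccontr)
    assume "\<not> \<bar>\<eta>0 w\<bar> < 1"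
    then have "1 \<le> \<bar>w \<bullet> v\<bar>"
      using lin [of w] w s(1) by (simp add: v_def abs_mult)
    \<comment> \<open>Both \<open>v\<close> and \<open>- v\<close> have norm at most 1, so either
      case is an equality case of Cauchy-Schwarz.\<close>
    then consider "1 \<le> w \<bullet> v" | "1 \<le> w \<bullet> - v" by force
    then have "w = v \<or> w = - v"
      using unit_vector_eq_if_inner_ge_1 [of w] nv w by cases auto
    then show False using w notC w0_eq by auto
  qed
  moreover have "z0' \<noteq> 0" using nz by force
  moreover have "w0 = s *\<^sub>R (z0' /\<^sub>R norm z0')"
    using w0_eq nz by (simp add: v_def)
  ultimately show ?thesis
    unfolding s_def by blast
qed

end
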